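(* Let $\mathbf{R}=\{r_1,\dots,r_n\}$ be a set of $n$ decision procedures, indexed in increasing order of quality, where $r_i$ has runtime $t_i$ and quality $q_i$. Let $P_d$ be the cumulative distribution function of a general deadline distribution, and let $L=\sum_{r_i\in\mathbf{R}}t_i$. Consider the following dynamic programming (DP) algorithm. It constructs the table $S(i,t)$, with $t$ ranging from the start time $0$ to the end time $L$, by the update rule $$S(i,t)=\max_{k\in[0\ldots i-1]}\big[S(k,t-t_i)+(q_i-q_k)[1-P_d(t)]\big]$$ with boundary condition $$S(i,0)=0\ \text{for each rule } i\quad\text{and}\quad S(0,t)=0\ \text{for each time } t,$$ and then reads off the best sequence from the highest value in row $n$ of the table. This DP algorithm computes an optimal sequence, for the stochastic deadline distributed according to $P_d$, in time $O(n^2L)$, where $n$ is the number of decision procedures in $\mathbf{R}$.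
   Context: A decision procedure (rule) $r_i$ recommends an action and has an integer runtime $t_i\ge 0$ and a real quality $q_i\ge 0$ (the expected reward from executing its recommended action). An agent program is a sequence $s=s_1\ldots s_m$ of elements of $\mathbf{R}$, whose rules are run in order. A deadline occurs at a random time with cumulative distribution function $P_d$ and is announced when it arrives. When the deadline arrives, or when the whole sequence has been completed, the agent executes the action recommended by the highest-quality rule it has completed. Writing $t_j$ and $q_j$ for the runtime and quality of the $j$-th rule $s_j$ of the sequence, the value of $s$ is $$V(s)=\sum_{i=1}^{m}\Big[P_d\Big(\sum_{j=1}^{i+1}t_j\Big)-P_d\Big(\sum_{j=1}^{i}t_j\Big)\Big]Q_i,\qquad Q_i=\max\{q_1,\dots,q_i\},$$ where for $i=m$ the term $P_d(\sum_{j=1}^{m+1}t_j)$ is read as $1$. A sequence is optimal if it maximizes $V$ over all sequences of rules from $\mathbf{R}$. The intended meaning of the table entry $S(i,t)$ is the highest value of any sequence (ordered by quality) that ends with rule $r_i$ at time $t$. The index $0$ in the table stands for "no rule", with $q_0=0$, and only entries with time argument in the range $0,\dots,L$ are used.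
   Formalization: For a rule with runtime t_i = 0 the update rule, not the boundary condition S(i,0)=0, is used at t = 0 (the two conflict there, and the boundary value can miss the optimum); the time bound O(n^2 L) is stated for L > 0 only. *)

theory Defs
  imports "HOL-Probability.Probability" "HOL-Library.State_Monad"
begin

text \<open>
  The rules are the indices \<open>1, \<dots>, n\<close>, with runtimes \<open>rt i\<close> and qualities \<open>q i\<close>; the index \<open>0\<close>
  stands for ``no rule''. The ordering by quality is the weak one: ties are allowed.
\<close>

definition rules_by_quality :: "nat \<Rightarrow> (nat \<Rightarrow> real) \<Rightarrow> bool" where
  "rules_by_quality n q \<longleftrightarrow> q 0 = 0 \<and> (\<forall>i\<in>{1..n}. 0 \<le> q i) \<and> mono_on {1..n} q"

definition total_runtime :: "nat \<Rightarrow> (nat \<Rightarrow> nat) \<Rightarrow> nat" where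
  "total_runtime n rt = (\<Sum>i=1..n. rt i)"


section \<open>The value of a sequence\<close>

text \<open>Positions in a sequence count from \<open>1\<close>, so the \<open>j\<close>-th rule of \<open>s\<close> is \<open>s ! (j - 1)\<close>.\<close>

definition completion_time :: "(nat \<Rightarrow> nat) \<Rightarrow> nat list \<Rightarrow> nat \<Rightarrow> nat" where
  "completion_time rt s i = (\<Sum>j=1..i. rt (s ! (j - 1)))"

definition best_quality :: "(nat \<Rightarrow> real) \<Rightarrow> nat list \<Rightarrow> nat \<Rightarrow> real" where
  "best_quality q s i = Max ((\<lambda>j. q (s ! (j - 1))) ` {1..i})"

definition seq_value :: "(nat \<Rightarrow> nat) \<Rightarrow> (nat \<Rightarrow> real) \<Rightarrow> (real \<Rightarrow> real) \<Rightarrow> nat list \<Rightarrow> real" where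
  "seq_value rt q P s =
     (\<Sum>i=1..length s.
        ((if i = length s then 1 else P (completion_time rt s (i + 1)))
          - P (completion_time rt s i)) * best_quality q s i)"

text \<open>Competing sequences are arbitrary: any length, any order, repetitions allowed.\<close>

definition optimal_sequence ::
  "nat \<Rightarrow> (nat \<Rightarrow> nat) \<Rightarrow> (nat \<Rightarrow> real) \<Rightarrow> (real \<Rightarrow> real) \<Rightarrow> nat list \<Rightarrow> bool" where
  "optimal_sequence n rt q P s \<longleftrightarrow>
     s \<in> lists {1..n} \<and> (\<forall>s'\<in>lists {1..n}. seq_value rt q P s' \<le> seq_value rt q P s)"


section \<open>The recurrence\<close>

text \<open>
  The update rule applies at \<open>(i, t)\<close> exactly when its references \<open>(k, t - rt i)\<close> lie inside the
  table, i.e. when \<open>rt i \<le> t\<close>. Otherwise the boundary value is \<open>0\<close> at time \<open>0\<close>, and at later times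
  the maximum is empty, hence \<open>-\<infinity>\<close>. The order of the two cases matters only for a rule of
  runtime \<open>0\<close> at time \<open>0\<close>: giving the boundary value precedence there would discard all zero-time
  rules, and the table would miss the optimum.
\<close>

fun dp_table :: "(nat \<Rightarrow> nat) \<Rightarrow> (nat \<Rightarrow> real) \<Rightarrow> (real \<Rightarrow> real) \<Rightarrow> nat \<Rightarrow> nat \<Rightarrow> ereal" where
  "dp_table rt q P i t =
     (if i = 0 then 0
      else if rt i \<le> t then
        MAX k\<in>{0..i - 1}. dp_table rt q P k (t - rt i) + ereal ((q i - q k) * (1 - P (real t)))
      else if t = 0 then 0
      else -\<infinity>)"

declare dp_table.simps [simp del]


section \<open>The algorithm\<close>

text \<open>
  The program runs on a unit-cost random access machine: \<open>clock\<close> counts the elementary operations,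
  namely the accesses to the two arrays, to the inputs \<open>rt\<close>, \<open>q\<close> and \<open>P\<close>, single arithmetic
  operations and comparisons (on extended reals, naturals and indices), list construction, and the
  loop tests. Branching on a computed boolean is free. The array \<open>choice\<close> holds the maximising
  index of each table entry, for reading off the sequence.

  The monad does not force an operation to be counted; the convention is that every \<open>step\<close>
  performs one operation and that nothing is computed outside a \<open>step\<close>.
\<close>

record machine =
  clock :: nat
  table :: "nat \<Rightarrow> nat \<Rightarrow> ereal"
  choice :: "nat \<Rightarrow> nat \<Rightarrow> nat"

type_synonym 'a prog = "(machine, 'a) state"

abbreviation return :: "'a \<Rightarrow> 'a prog" where
  "return \<equiv> State_Monad.return"

definition step :: "'a \<Rightarrow> 'a prog" where
  "step a = State (\<lambda>m. (a, m\<lparr>clock := clock m + 1\<rparr>))"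

definition read_table :: "nat \<Rightarrow> nat \<Rightarrow> ereal prog" where
  "read_table i t = State (\<lambda>m. (table m i t, m\<lparr>clock := clock m + 1\<rparr>))"

definition write_table :: "nat \<Rightarrow> nat \<Rightarrow> ereal \<Rightarrow> unit prog" where
  "write_table i t v =
     State (\<lambda>m. ((), m\<lparr>clock := clock m + 1, table := (table m)(i := (table m i)(t := v))\<rparr>))"

definition read_choice :: "nat \<Rightarrow> nat \<Rightarrow> nat prog" where
  "read_choice i t = State (\<lambda>m. (choice m i t, m\<lparr>clock := clock m + 1\<rparr>))"

definition write_choice :: "nat \<Rightarrow> nat \<Rightarrow> nat \<Rightarrow> unit prog" where
  "write_choice i t k =
     State (\<lambda>m. ((), m\<lparr>clock := clock m + 1, choice := (choice m)(i := (choice m i)(t := k))\<rparr>))"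

text \<open>A \<open>for\<close> loop over an index range, passing on the local variables of the loop body.\<close>

primrec for_loop :: "nat list \<Rightarrow> (nat \<Rightarrow> 'a \<Rightarrow> 'a prog) \<Rightarrow> 'a \<Rightarrow> 'a prog" where
  "for_loop [] body a = step a"
| "for_loop (j # js) body a = do { _ \<leftarrow> step (); a' \<leftarrow> body j a; for_loop js body a' }"

definition compute_horizon :: "nat \<Rightarrow> (nat \<Rightarrow> nat) \<Rightarrow> nat prog" where
  "compute_horizon n rt =
     for_loop [1..<Suc n] (\<lambda>i L. do { r \<leftarrow> step (rt i); step (L + r) }) 0"

text \<open>Here \<open>w\<close> is the survival probability at the current time, and \<open>u\<close> the time minus \<open>rt i\<close>.\<close>

definition candidate :: "(nat \<Rightarrow> real) \<Rightarrow> nat \<Rightarrow> nat \<Rightarrow> real \<Rightarrow> nat \<Rightarrow> ereal prog" where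
  "candidate q i u w k = do {
     v \<leftarrow> read_table k u;
     qi \<leftarrow> step (q i);
     qk \<leftarrow> step (q k);
     d \<leftarrow> step (qi - qk);
     g \<leftarrow> step (d * w);
     step (v + ereal g)
   }"

definition fill_entry ::
  "(nat \<Rightarrow> nat) \<Rightarrow> (nat \<Rightarrow> real) \<Rightarrow> (real \<Rightarrow> real) \<Rightarrow> nat \<Rightarrow> nat \<Rightarrow> unit prog" where
  "fill_entry rt q P i t = do {
     r \<leftarrow> step (rt i);
     fits \<leftarrow> step (r \<le> t);
     if fits then do {
       u \<leftarrow> step (t - r);
       p \<leftarrow> step (P (real t));
       w \<leftarrow> step (1 - p);
       v0 \<leftarrow> candidate q i u w 0;
       (k, v) \<leftarrow> for_loop [1..<i] (\<lambda>k' (k, v). do {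
         v' \<leftarrow> candidate q i u w k';
         better \<leftarrow> step (v < v');
         return (if better then (k', v') else (k, v))
       }) (0, v0);
       _ \<leftarrow> write_choice i t k;
       write_table i t v
     } else do {
       start \<leftarrow> step (t = 0);
       write_table i t (if start then 0 else -\<infinity>)
     }
   }"

definition fill_table ::
  "nat \<Rightarrow> (nat \<Rightarrow> nat) \<Rightarrow> (nat \<Rightarrow> real) \<Rightarrow> (real \<Rightarrow> real) \<Rightarrow> nat \<Rightarrow> unit prog" where
  "fill_table n rt q P L = do {
     _ \<leftarrow> for_loop [0..<Suc L] (\<lambda>t _. write_table 0 t 0) ();
     for_loop [1..<Suc n] (\<lambda>i _. for_loop [0..<Suc L] (\<lambda>t _. fill_entry rt q P i t) ()) ()
   }"

definition best_end_time :: "nat \<Rightarrow> nat \<Rightarrow> nat prog" where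
  "best_end_time n L = do {
     v0 \<leftarrow> read_table n 0;
     (t, v) \<leftarrow> for_loop [1..<Suc L] (\<lambda>t' (t, v). do {
       v' \<leftarrow> read_table n t';
       better \<leftarrow> step (v < v');
       return (if better then (t', v') else (t, v))
     }) (0, v0);
     return t
   }"

text \<open>
  Following the maximising indices back from \<open>(n, t)\<close> until a boundary entry is reached. The index
  decreases strictly, so \<open>n\<close> rounds suffice; rounds at a boundary entry do nothing.
\<close>

definition trace_back :: "nat \<Rightarrow> (nat \<Rightarrow> nat) \<Rightarrow> nat \<Rightarrow> nat list prog" where
  "trace_back n rt t = do {
     (_, _, s) \<leftarrow> for_loop [0..<n] (\<lambda>_ (i, t, s). do {
       none \<leftarrow> step (i = 0);
       if none then return (i, t, s)
       else do {
         r \<leftarrow> step (rt i);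
         fits \<leftarrow> step (r \<le> t);
         if fits then do {
           k \<leftarrow> read_choice i t;
           u \<leftarrow> step (t - r);
           s' \<leftarrow> step (i # s);
           return (k, u, s')
         } else return (i, t, s)
       }
     }) (n, t, []);
     return s
   }"

definition dp_algorithm ::
  "nat \<Rightarrow> (nat \<Rightarrow> nat) \<Rightarrow> (nat \<Rightarrow> real) \<Rightarrow> (real \<Rightarrow> real) \<Rightarrow> nat list prog" where
  "dp_algorithm n rt q P = do {
     L \<leftarrow> compute_horizon n rt;
     _ \<leftarrow> fill_table n rt q P L;
     t \<leftarrow> best_end_time n L;
     trace_back n rt t
   }"

end

theory Submission
  imports Defs
begin

text \<open>
  Summation by parts turns the value of a sequence into a sum over its quality improvements, each
  weighted with the survival probability at the completion time. Dropping the rules that bring no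
  improvement only makes the other ones finish earlier, and what remains is increasing in the index;
  hence row \<open>n\<close> of the table dominates every sequence. Conversely, the path that the trace follows
  back through the table yields a sequence at least as good as the entry it starts from: waiting
  before the first rule, or starting at a boundary entry \<open>(i, 0)\<close>, only loses value.
\<close>

section \<open>The value of a sequence extended by one rule\<close>

text \<open>The inserted \<open>0\<close> gives the empty sequence the quality of index
  \<open>0\<close>, where \<open>best_quality\<close> would take the \<open>Max\<close> of an empty
  set.\<close>

definition top_quality :: "(nat \<Rightarrow> real) \<Rightarrow> nat list \<Rightarrow> real" where
  "top_quality q s = Max (insert 0 (q ` set s))"

definition run_time :: "(nat \<Rightarrow> nat) \<Rightarrow> nat list \<Rightarrow> nat" where
  "run_time rt s = sum_list (map rt s)"

lemma top_quality_Nil [simp]: "top_quality q [] = 0"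
  by (simp add: top_quality_def)

lemma top_quality_snoc: "top_quality q (s @ [i]) = max (top_quality q s) (q i)"
proof -
  have "insert 0 (q ` set (s @ [i])) = insert (q i) (insert 0 (q ` set s))" by auto
  then show ?thesis
    unfolding top_quality_def by (simp add: Max_insert max.commute del: insert_commute)
qed

lemma run_time_Nil [simp]: "run_time rt [] = 0"
  and run_time_snoc [simp]: "run_time rt (s @ [i]) = run_time rt s + rt i"
  by (simp_all add: run_time_def)

lemma completion_time_append:
  "j \<le> length s \<Longrightarrow> completion_time rt (s @ s') j = completion_time rt s j"
  unfolding completion_time_def by (rule sum.cong) (auto simp: nth_append)

lemma best_quality_append:
  "j \<le> length s \<Longrightarrow> best_quality q (s @ s') j = best_quality q s j"
  unfolding best_quality_def by (intro arg_cong[where f = Max] image_cong) (auto simp: nth_append)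

lemma completion_time_length: "completion_time rt s (length s) = run_time rt s"
proof (induction s rule: rev_induct)
  case Nil
  then show ?case by (simp add: completion_time_def)
next
  case (snoc i s)
  have "completion_time rt (s @ [i]) (Suc (length s)) =
      completion_time rt (s @ [i]) (length s) + rt i"
    by (simp add: completion_time_def)
  then show ?case using snoc by (simp add: completion_time_append)
qed

text \<open>Qualities are nonnegative and \<open>s\<close> is nonempty, so the \<open>0\<close>
  inserted in \<open>top_quality\<close> does not change the maximum.\<close>

lemma best_quality_length:
  assumes "s \<noteq> []" "\<forall>i\<in>set s. 0 \<le> q i"
  shows "best_quality q s (length s) = top_quality q s"
proof -
  have "(\<lambda>j. s ! (j - 1)) ` {1..length s} = set s"
  proof -
    have "{1..length s} = Suc ` {..<length s}"
      by (simp add: image_Suc_lessThan)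
    then show ?thesis by (auto simp: image_image set_conv_nth)
  qed
  then have img: "(\<lambda>j. q (s ! (j - 1))) ` {1..length s} = q ` set s"
    by (metis image_image)
  have "0 \<le> Max (q ` set s)"
    using assms by (subst Max_ge_iff) (auto simp: neq_Nil_conv)
  then show ?thesis
    unfolding best_quality_def top_quality_def img using assms by (simp add: Max_insert max_absorb2)
qed

lemma seq_value_Nil [simp]: "seq_value rt q P [] = 0"
  by (simp add: seq_value_def)

text \<open>Appending \<open>i\<close> changes the sum in two places: the \<open>1\<close> in the
  old last summand becomes \<open>P\<close> at the new completion time, and a new last summand
  appears. Together they contribute the quality gain times the survival probability, which is the
  increment in the update rule.\<close>

lemma seq_value_snoc:
  assumes "\<forall>j\<in>set (s @ [i]). 0 \<le> q j"
  shows "seq_value rt q P (s @ [i]) = seq_value rt q P s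
    + (max (top_quality q s) (q i) - top_quality q s) * (1 - P (real (run_time rt s + rt i)))"
proof -
  let ?T = "completion_time rt" and ?Q = "best_quality q" and ?s = "s @ [i]"
  have Tlast: "?T ?s (Suc (length s)) = run_time rt s + rt i"
    using completion_time_length[of rt ?s] by simp
  have Qlast: "?Q ?s (Suc (length s)) = max (top_quality q s) (q i)"
    using best_quality_length[of ?s q] assms by (simp add: top_quality_snoc)
  define f where "f j = (P (real (?T ?s (j + 1))) - P (real (?T ?s j))) * ?Q ?s j" for j
  have "seq_value rt q P ?s = (\<Sum>j = 1..length s. f j)
      + (1 - P (real (run_time rt s + rt i))) * max (top_quality q s) (q i)"
    unfolding seq_value_def by (simp add: Tlast Qlast f_def)
  moreover have "(\<Sum>j = 1..length s. f j) = seq_value rt q P s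
      - (1 - P (real (run_time rt s + rt i))) * top_quality q s"
  \<comment> \<open>Only a nonempty \<open>s\<close> has a last summand to correct; for the empty
    one both sides are \<open>0\<close>.\<close>
  proof (cases "s = []")
    case False
    then obtain l where l: "length s = Suc l" by (cases s) auto
    have eq: "?T s (Suc l) = run_time rt s" "?Q s (Suc l) = top_quality q s"
      using completion_time_length[of rt s] best_quality_length[OF False, of q] assms
      by (simp_all add: l)
    have "f (Suc l) = (P (real (run_time rt s + rt i)) - P (real (run_time rt s))) * top_quality q s"
      using Tlast eq by (simp add: f_def l completion_time_append best_quality_append)
    moreover have "(\<Sum>j = 1..l. f j) =
        (\<Sum>j = 1..l. (P (real (?T s (j + 1))) - P (real (?T s j))) * ?Q s j)"
      by (rule sum.cong) (auto simp: f_def l completion_time_append best_quality_append)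
    moreover have "seq_value rt q P s =
        (\<Sum>j = 1..l. (P (real (?T s (j + 1))) - P (real (?T s j))) * ?Q s j)
        + (1 - P (real (run_time rt s))) * top_quality q s"
      unfolding seq_value_def l by (simp add: eq)
    ultimately show ?thesis by (simp add: l algebra_simps)
  qed simp
  ultimately show ?thesis by (simp add: algebra_simps)
qed

section \<open>The table dominates every sequence\<close>

text \<open>Monotonicity of \<open>P\<close> makes an earlier completion at least as good, and the
  bound by \<open>1\<close> makes survival probabilities nonnegative.\<close>

locale deadline_problem =
  fixes n :: nat and rt :: "nat \<Rightarrow> nat" and q :: "nat \<Rightarrow> real" and P :: "real \<Rightarrow> real"
  assumes rules: "rules_by_quality n q"
    and P_mono: "mono P"
    and P_le_1: "P x \<le> 1"
begin

abbreviation "S \<equiv> dp_table rt q P"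
abbreviation "V \<equiv> seq_value rt q P"
abbreviation "L \<equiv> total_runtime n rt"

abbreviation extension :: "nat \<Rightarrow> nat \<Rightarrow> nat \<Rightarrow> ereal" where
  "extension i t k \<equiv> S k (t - rt i) + ereal ((q i - q k) * (1 - P (real t)))"

lemma q_0: "q 0 = 0"
  using rules by (simp add: rules_by_quality_def)

lemma q_mono: "i \<le> j \<Longrightarrow> j \<le> n \<Longrightarrow> q i \<le> q j"
  using rules by (cases "i = 0"; cases "j = 0") (auto simp: rules_by_quality_def mono_on_def)

lemma q_nonneg: "i \<le> n \<Longrightarrow> 0 \<le> q i"
  using q_mono[of 0 i] q_0 by simp

lemma S_0 [simp]: "S 0 t = 0"
  by (simp add: dp_table.simps)

lemma S_update: "0 < i \<Longrightarrow> rt i \<le> t \<Longrightarrow> S i t = Max (extension i t ` {0..i - 1})"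
  by (subst dp_table.simps) simp

lemma S_boundary: "i = 0 \<or> t < rt i \<Longrightarrow> S i t \<le> 0"
  by (subst dp_table.simps) auto

lemma extension_le_S:
  assumes "k < i" "rt i \<le> t"
  shows "extension i t k \<le> S i t"
  using assms by (subst S_update) (auto intro!: Max_ge)

lemma seq_value_extend:
  assumes "s \<in> lists {1..n}" "i \<in> {1..n}"
  shows "V (s @ [i]) = V s + (max (top_quality q s) (q i) - top_quality q s)
    * (1 - P (real (run_time rt s + rt i)))"
  by (rule seq_value_snoc) (use assms q_nonneg in auto)

text \<open>Induction along the sequence, keeping an entry that tracks only the improving rules. The
  bound by \<open>run_time\<close> lets the entry finish no later than \<open>s\<close>. The bound
  by the runtimes of the first \<open>k\<close> rules keeps \<open>t\<close> inside the table, even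
  if repetitions make \<open>s\<close> run longer than \<open>L\<close>.\<close>

lemma seq_value_le_some_entry:
  assumes "s \<in> lists {1..n}"
  shows "\<exists>k\<le>n. \<exists>t. q k = top_quality q s \<and> t \<le> run_time rt s \<and> t \<le> (\<Sum>j=1..k. rt j)
    \<and> ereal (V s) \<le> S k t"
  using assms
proof (induction s rule: rev_induct)
  case Nil
  then show ?case by (intro exI[of _ 0]) (simp add: q_0 zero_ereal_def)
next
  case (snoc i s)
  then have s: "s \<in> lists {1..n}" and i: "i \<in> {1..n}" by auto
  obtain k t where k: "k \<le> n" "q k = top_quality q s" "t \<le> run_time rt s"
      "t \<le> (\<Sum>j=1..k. rt j)" "ereal (V s) \<le> S k t"
    using snoc.IH[OF s] by blast
  show ?case
  proof (cases "q i \<le> top_quality q s")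
    \<comment> \<open>A rule without gain adds nothing to the value, so the old entry still serves
      and its time does not advance.\<close>
    case True
    with k show ?thesis
      by (intro exI[of _ k] conjI exI[of _ t])
        (auto simp: top_quality_snoc seq_value_extend[OF s i])
  next
    case False
    then have qi: "max (top_quality q s) (q i) = q i" "q k < q i" using k by auto
    \<comment> \<open>A strict gain in quality forces a larger index even in the presence of ties,
      so the recurrence at \<open>i\<close> may refer to \<open>k\<close>.\<close>
    have "k < i"
      using qi(2) q_mono[of i k] k(1) by (cases "k < i") auto
    have "(\<Sum>j=1..k. rt j) + rt i \<le> (\<Sum>j=1..i. rt j)"
    proof -
      obtain i' where i': "i = Suc i'" "k \<le> i'" using \<open>k < i\<close> by (cases i) auto
      have "(\<Sum>j=1..k. rt j) \<le> (\<Sum>j=1..i'. rt j)" using i' by (intro sum_mono2) auto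
      then show ?thesis by (simp add: i')
    qed
    then have t: "t + rt i \<le> (\<Sum>j=1..i. rt j)" using k by simp
    have "(q i - q k) * (1 - P (real (run_time rt s + rt i)))
        \<le> (q i - q k) * (1 - P (real (t + rt i)))"
      using qi k by (intro mult_left_mono diff_left_mono monoD[OF P_mono]) auto
    then have "ereal (V (s @ [i])) \<le> ereal (V s) + ereal ((q i - q k) * (1 - P (real (t + rt i))))"
      by (simp add: seq_value_extend[OF s i] qi k(2))
    also have "\<dots> \<le> extension i (t + rt i) k"
      using add_right_mono[OF k(5), of "ereal ((q i - q k) * (1 - P (real (t + rt i))))"] by simp
    also have "\<dots> \<le> S i (t + rt i)"
      using \<open>k < i\<close> by (intro extension_le_S) auto
    finally show ?thesis
      using i t k qi by (intro exI[of _ i] conjI exI[of _ "t + rt i"]) (auto simp: top_quality_snoc)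
  qed
qed

text \<open>An entry in a row \<open>k < n\<close> is carried to row \<open>n\<close> by appending
  rule \<open>n\<close>. The gain is nonnegative, and the time stays within \<open>L\<close> because
  the first \<open>k\<close> rules do not include rule \<open>n\<close>.\<close>

lemma seq_value_le_last_row:
  assumes "s \<in> lists {1..n}"
  shows "\<exists>t\<le>L. ereal (V s) \<le> S n t"
proof -
  obtain k t where k: "k \<le> n" "t \<le> (\<Sum>j=1..k. rt j)" "ereal (V s) \<le> S k t"
    using seq_value_le_some_entry[OF assms] by blast
  show ?thesis
  proof (cases "k = n")
    case True
    then show ?thesis using k by (auto simp: total_runtime_def)
  next
    case False
    then obtain n' where n': "n = Suc n'" "k \<le> n'" using k(1) by (cases n) auto
    have "(\<Sum>j=1..k. rt j) \<le> (\<Sum>j=1..n'. rt j)" using n' by (intro sum_mono2) auto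
    then have t: "t + rt n \<le> L" using k by (simp add: n' total_runtime_def)
    have "0 \<le> (q n - q k) * (1 - P (real (t + rt n)))"
      using q_mono[OF k(1)] P_le_1[of "real (t + rt n)"] by simp
    then have "S k t + 0 \<le> S k t + ereal ((q n - q k) * (1 - P (real (t + rt n))))"
      by (intro add_left_mono) (simp add: zero_ereal_def)
    then have "ereal (V s) \<le> extension n (t + rt n) k"
      using k(3) by simp
    also have "\<dots> \<le> S n (t + rt n)"
      using n' by (intro extension_le_S) auto
    finally show ?thesis using t by blast
  qed
qed

text \<open>
  The invariant of the trace. It quantifies over all prefixes at least as good as the entry
  \<open>(i, t)\<close>, so that it is preserved without knowing the optimal prefix, and an entry \<open>-\<infinity>\<close> needs
  no special treatment.
\<close>

definition completes :: "ereal \<Rightarrow> nat \<Rightarrow> nat \<Rightarrow> nat list \<Rightarrow> bool" where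
  "completes v i t s \<longleftrightarrow> s \<in> lists {1..n} \<and>
     (\<forall>s'\<in>lists {1..n}. top_quality q s' \<le> q i \<longrightarrow> run_time rt s' \<le> t \<longrightarrow> S i t \<le> ereal (V s')
        \<longrightarrow> v \<le> ereal (V (s' @ s)))"

lemma completes_Nil: "completes (S n t) n t []"
  by (auto simp: completes_def)

text \<open>A prefix admissible for \<open>(k, t - rt i)\<close> becomes admissible for
  \<open>(i, t)\<close> once \<open>i\<close> is appended. If it has lower quality than
  \<open>q k\<close> or finishes early, the true gain from \<open>i\<close> is at least the one
  credited by the table.\<close>

lemma completes_step:
  assumes "completes v i t s" "i \<in> {1..n}" "rt i \<le> t" "k < i" "S i t = extension i t k"
  shows "completes v k (t - rt i) (i # s)"
  unfolding completes_def
proof (intro conjI ballI impI)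
  show "i # s \<in> lists {1..n}" using assms by (auto simp: completes_def)
next
  fix s' assume s': "s' \<in> lists {1..n}" "top_quality q s' \<le> q k" "run_time rt s' \<le> t - rt i"
    "S k (t - rt i) \<le> ereal (V s')"
  have ki: "q k \<le> q i" using assms by (intro q_mono) auto
  have "P (real (run_time rt s' + rt i)) \<le> P (real t)"
    using s' assms by (intro monoD[OF P_mono]) auto
  then have "(q i - q k) * (1 - P (real t))
      \<le> (q i - top_quality q s') * (1 - P (real (run_time rt s' + rt i)))"
    using s' ki P_le_1 by (intro mult_mono) auto
  moreover have "max (top_quality q s') (q i) = q i" using s' ki by auto
  ultimately have "V s' + (q i - q k) * (1 - P (real t)) \<le> V (s' @ [i])"
    by (simp add: seq_value_extend[OF s'(1) assms(2)])
  moreover have "S i t \<le> ereal (V s') + ereal ((q i - q k) * (1 - P (real t)))"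
    unfolding assms(5) using s'(4) by (rule add_right_mono)
  ultimately have "S i t \<le> ereal (V (s' @ [i]))"
    by (metis ereal_less_eq(3) order_trans plus_ereal.simps(1))
  moreover have "top_quality q (s' @ [i]) \<le> q i" "run_time rt (s' @ [i]) \<le> t"
    "s' @ [i] \<in> lists {1..n}"
    using s' ki assms by (auto simp: top_quality_snoc)
  ultimately have "v \<le> ereal (V ((s' @ [i]) @ s))"
    using assms(1) unfolding completes_def by blast
  then show "v \<le> ereal (V (s' @ i # s))" by simp
qed

text \<open>The empty prefix is admissible here: its value is \<open>0\<close>, which is at least
  any boundary entry.\<close>

lemma completes_boundary:
  assumes "completes v i t s" "i \<le> n" "i = 0 \<or> t < rt i"
  shows "v \<le> ereal (V s)"
  using assms(1)[unfolded completes_def, THEN conjunct2, rule_format, of "[]"] S_boundary[OF assms(3)]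
    q_nonneg[OF assms(2)] by (simp add: zero_ereal_def)

lemma optimal_if_dominates_row:
  assumes "s \<in> lists {1..n}" "v \<le> ereal (V s)" "\<And>t. t \<le> L \<Longrightarrow> S n t \<le> v"
  shows "optimal_sequence n rt q P s"
  unfolding optimal_sequence_def
proof (intro conjI ballI)
  fix s' assume "s' \<in> lists {1..n}"
  then obtain t where "t \<le> L" "ereal (V s') \<le> S n t" using seq_value_le_last_row by blast
  then have "ereal (V s') \<le> ereal (V s)" using assms by (meson order_trans)
  then show "V s' \<le> V s" by simp
qed fact

end

section \<open>Weakest preconditions\<close>

definition wp :: "'a prog \<Rightarrow> ('a \<Rightarrow> machine \<Rightarrow> bool) \<Rightarrow> machine \<Rightarrow> bool" where
  "wp p Q m = (case run_state p m of (a, m') \<Rightarrow> Q a m')"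

text \<open>A named clock update keeps symbolic execution from piling up nested record
  updates.\<close>

definition tick :: "machine \<Rightarrow> machine" where
  "tick m = m\<lparr>clock := clock m + 1\<rparr>"

lemma tick_simps [simp]:
  "clock (tick m) = Suc (clock m)" "table (tick m) = table m" "choice (tick m) = choice m"
  by (simp_all add: tick_def)

lemma wp_simps [simp]:
  "wp (return a) Q m = Q a m"
  "wp (State_Monad.bind p' f) Q m = wp p' (\<lambda>a. wp (f a) Q) m"
  "wp (step a) Q m = Q a (tick m)"
  "wp (read_table i t) Qv m = Qv (table m i t) (tick m)"
  "wp (read_choice i t) Qk m = Qk (choice m i t) (tick m)"
  "wp (write_table i t v) Qu m =
     Qu () ((tick m)\<lparr>table := (table m)(i := (table m i)(t := v))\<rparr>)"
  "wp (write_choice i t k) Qu m =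
     Qu () ((tick m)\<lparr>choice := (choice m)(i := (choice m i)(t := k))\<rparr>)"
  "wp (if b then p1 else p2) Q m = (if b then wp p1 Q m else wp p2 Q m)"
  by (auto simp: wp_def step_def read_table_def read_choice_def write_table_def write_choice_def
      tick_def State_Monad.bind_def State_Monad.return_def split: prod.splits)

lemma wp_mono: "wp p Q m \<Longrightarrow> (\<And>a m. Q a m \<Longrightarrow> Q' a m) \<Longrightarrow> wp p Q' m"
  by (auto simp: wp_def split: prod.splits)

text \<open>\<open>I j\<close> describes the state before the loop test of round \<open>j\<close>.
  Each \<open>tick\<close> in the premises pays for one test, including the final one that leaves
  the loop.\<close>

lemma wp_for_loop:
  assumes "I lo a m" "lo \<le> hi"
    and "\<And>j a m. lo \<le> j \<Longrightarrow> j < hi \<Longrightarrow> I j a m \<Longrightarrow> wp (body j a) (I (Suc j)) (tick m)"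
    and "\<And>a m. I hi a m \<Longrightarrow> Q a (tick m)"
  shows "wp (for_loop [lo..<hi] body a) Q m"
  using assms(2,1,3)
proof (induction lo arbitrary: a m rule: inc_induct)
  case base
  then show ?case using assms(4) by simp
next
  case (step lo)
  have "wp (body lo a) (I (Suc lo)) (tick m)" using step.hyps step.prems by auto
  then have "wp (body lo a) (\<lambda>a. wp (for_loop [Suc lo..<hi] body a) Q) (tick m)"
    by (rule wp_mono) (use step in auto)
  then show ?case using step.hyps by (simp add: upt_conv_Cons)
qed

section \<open>Correctness and running time of the algorithm\<close>

lemma wp_compute_horizon:
  "wp (compute_horizon n rt)
     (\<lambda>L m. L = total_runtime n rt \<and> clock m \<le> clock m0 + 3 * n + 1) m0"
  unfolding compute_horizon_def
  \<comment> \<open>A round costs one test, one read and one addition. The index starts at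
    \<open>1\<close>, hence the \<open>3\<close> on the left.\<close>
  by (rule wp_for_loop[where I = "\<lambda>j a m. a = (\<Sum>i\<in>{1..<j}. rt i) \<and> clock m + 3 \<le> clock m0 + 3 * j"])
    (auto simp: total_runtime_def simp flip: atLeastLessThanSuc_atLeastAtMost)

lemma wp_candidate [simp]:
  "wp (candidate q i u w k) Q m =
     Q (table m k u + ereal ((q i - q k) * w)) ((tick ^^ 6) m)"
  by (simp add: candidate_def numeral_eq_Suc)

lemma funpow_tick_simps [simp]:
  "clock ((tick ^^ k) m) = k + clock m" "table ((tick ^^ k) m) = table m"
  "choice ((tick ^^ k) m) = choice m"
  by (induction k) auto

context deadline_problem
begin

section \<open>Filling the table in row-major order\<close>

definition entry_ok :: "machine \<Rightarrow> nat \<Rightarrow> nat \<Rightarrow> bool" where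
  "entry_ok m i t \<longleftrightarrow> table m i t = S i t \<and>
     (0 < i \<and> rt i \<le> t \<longrightarrow> choice m i t < i \<and> S i t = extension i t (choice m i t))"

definition filled :: "nat \<Rightarrow> nat \<Rightarrow> machine \<Rightarrow> bool" where
  "filled i t m \<longleftrightarrow> (\<forall>j u. u \<le> L \<longrightarrow> j < i \<or> j = i \<and> u < t \<longrightarrow> entry_ok m j u)"

lemma filled_tick [simp]: "filled i t (tick m) = filled i t m"
  by (simp add: filled_def entry_ok_def)

lemma filled_next_row: "filled i (Suc L) m \<Longrightarrow> filled (Suc i) 0 m"
  unfolding filled_def less_Suc_eq by (metis less_Suc_eq_le less_Suc_eq not_less_zero)

lemma filled_update:
  assumes "filled i t m" "entry_ok m' i t"
    and "\<And>j u. j \<noteq> i \<or> u \<noteq> t \<Longrightarrow> table m' j u = table m j u \<and> choice m' j u = choice m j u"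
  shows "filled i (Suc t) m'"
  unfolding filled_def
proof (intro allI impI)
  fix j u assume u: "u \<le> L" "j < i \<or> j = i \<and> u < Suc t"
  show "entry_ok m' j u"
  proof (cases "j = i \<and> u = t")
    case False
    then have "entry_ok m j u" using assms(1) u by (auto simp: filled_def less_Suc_eq)
    then show ?thesis using assms(3)[of j u] False by (auto simp: entry_ok_def)
  qed (use assms in auto)
qed

lemma wp_fill_entry:
  assumes "filled i t m0" "0 < i" "t \<le> L"
  shows "wp (fill_entry rt q P i t)
    (\<lambda>_ m. filled i (Suc t) m \<and> clock m \<le> clock m0 + 14 + 8 * i) m0"
proof (cases "rt i \<le> t")
  case True
  \<comment> \<open>All references go to earlier rows and to times at most \<open>t\<close>, hence
    to finished entries.\<close>
  have tab: "table m0 k (t - rt i) = S k (t - rt i)" if "k < i" for k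
    using assms that by (auto simp: filled_def entry_ok_def)
  \<comment> \<open>Candidate \<open>0\<close> is evaluated before the loop, \<open>11\<close>
    operations after the start. Each round costs \<open>8\<close>: a test, six operations for the
    candidate, and a comparison.\<close>
  define I where "I = (\<lambda>j (k, v) (m :: machine). table m = table m0 \<and> choice m = choice m0
    \<and> clock m + 8 = clock m0 + 11 + 8 * j \<and> k < j \<and> v = extension i t k
    \<and> (\<forall>k'<j. extension i t k' \<le> v))"
  show ?thesis
    unfolding fill_entry_def
    apply (simp add: True)
    apply (rule wp_for_loop[where I = I])
    subgoal using tab assms by (auto simp: I_def)
    subgoal using assms by simp
    subgoal for j a m
      using tab[of j] by (cases a) (auto simp: I_def less_Suc_eq not_less intro: order_trans less_imp_le)
    subgoal for a m
    proof -
      assume "I i a m"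
      moreover obtain k v where a: "a = (k, v)" by (cases a)
      ultimately have m: "table m = table m0" "choice m = choice m0"
          "clock m + 8 = clock m0 + 11 + 8 * i"
        and k: "k < i" "v = extension i t k" "\<forall>k'<i. extension i t k' \<le> v"
        by (auto simp: I_def)
      have "S i t = v"
        unfolding S_update[OF assms(2) True]
        by (rule Max_eqI) (use k assms in auto)
      then show ?thesis
        using m k assms by (auto simp: a entry_ok_def intro!: filled_update[OF assms(1)])
    qed
    done
next
  case False
  then have "S i t = (if t = 0 then 0 else -\<infinity>)"
    using assms by (subst dp_table.simps) simp
  then show ?thesis
    using False assms(1)
    by (auto simp: fill_entry_def entry_ok_def intro!: filled_update[where m = m0])
qed

text \<open>Each of the \<open>L + 1\<close> entries costs at most \<open>14 + 8 * n\<close> plus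
  its loop test. The \<open>2\<close> pays for the test of the outer loop and the exit test of the
  inner one.\<close>

abbreviation "row_time \<equiv> 2 + (L + 1) * (15 + 8 * n)"

lemma wp_fill_table:
  "wp (fill_table n rt q P L)
     (\<lambda>_ m. filled (Suc n) 0 m \<and> clock m \<le> clock m0 + 2 * L + 4 + n * row_time) m0"
  unfolding fill_table_def wp_simps
proof (rule wp_for_loop[where I = "\<lambda>t _ m. filled 0 t m \<and> clock m = clock m0 + 2 * t"])
  fix t a m assume "filled 0 t m \<and> clock m = clock m0 + 2 * t"
  then show "wp (write_table 0 t 0)
      (\<lambda>_ m. filled 0 (Suc t) m \<and> clock m = clock m0 + 2 * Suc t) (tick m)"
    by (auto simp: entry_ok_def intro!: filled_update[of 0 t m])
next
  fix a m assume m: "filled 0 (Suc L) m \<and> clock m = clock m0 + 2 * Suc L"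
  show "wp (for_loop [1..<Suc n]
        (\<lambda>i _. for_loop [0..<Suc L] (\<lambda>t _. fill_entry rt q P i t) ()) ())
      (\<lambda>_ m. filled (Suc n) 0 m \<and> clock m \<le> clock m0 + 2 * L + 4 + n * row_time) (tick m)"
  proof (rule wp_for_loop[where I = "\<lambda>i _ m. filled i 0 m
        \<and> clock m \<le> clock m0 + 2 * L + 3 + (i - 1) * row_time"])
    fix i a m assume i: "1 \<le> i" "i < Suc n"
      and m: "filled i 0 m \<and> clock m \<le> clock m0 + 2 * L + 3 + (i - 1) * row_time"
    show "wp (for_loop [0..<Suc L] (\<lambda>t _. fill_entry rt q P i t) ())
        (\<lambda>_ m. filled (Suc i) 0 m \<and> clock m \<le> clock m0 + 2 * L + 3 + (Suc i - 1) * row_time)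
        (tick m)"
    proof (rule wp_for_loop[where I = "\<lambda>t _ m'. filled i t m'
          \<and> clock m' \<le> clock m + 1 + t * (15 + 8 * n)"])
      fix t a m' assume t: "t < Suc L"
        and m': "filled i t m' \<and> clock m' \<le> clock m + 1 + t * (15 + 8 * n)"
      have "wp (fill_entry rt q P i t)
          (\<lambda>_ m''. filled i (Suc t) m'' \<and> clock m'' \<le> clock (tick m') + 14 + 8 * i) (tick m')"
        using m' t i by (intro wp_fill_entry) auto
      then show "wp (fill_entry rt q P i t) (\<lambda>_ m'. filled i (Suc t) m'
          \<and> clock m' \<le> clock m + 1 + Suc t * (15 + 8 * n)) (tick m')"
        by (rule wp_mono) (use m' i in auto)
    next
      fix a m' assume m': "filled i (Suc L) m' \<and> clock m' \<le> clock m + 1 + Suc L * (15 + 8 * n)"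
      \<comment> \<open>This removes the truncated subtraction in \<open>i - 1\<close>.\<close>
      obtain i' where "i = Suc i'" using i by (cases i) auto
      then show "filled (Suc i) 0 (tick m')
          \<and> clock (tick m') \<le> clock m0 + 2 * L + 3 + (Suc i - 1) * row_time"
        using m m' by (auto intro: filled_next_row)
    qed (use m in auto)
  qed (use m filled_next_row[of 0] in auto)
qed (auto simp: filled_def)

section \<open>Reading off the best sequence\<close>

lemma wp_best_end_time:
  assumes "\<And>t. t \<le> L \<Longrightarrow> table m0 n t = S n t"
  shows "wp (best_end_time n L)
    (\<lambda>t m. table m = table m0 \<and> choice m = choice m0 \<and> clock m \<le> clock m0 + 3 * L + 2
       \<and> t \<le> L \<and> (\<forall>t'\<le>L. S n t' \<le> S n t)) m0"
proof -
  define I where "I = (\<lambda>j (t, v) (m :: machine). table m = table m0 \<and> choice m = choice m0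
    \<and> clock m + 2 = clock m0 + 3 * j \<and> t < j \<and> t \<le> L \<and> v = S n t \<and> (\<forall>t'<j. S n t' \<le> v))"
  show ?thesis
    unfolding best_end_time_def wp_simps
    apply (rule wp_for_loop[where I = I])
    subgoal using assms by (auto simp: I_def)
    subgoal by simp
    subgoal for j a m
      using assms[of j]
      by (cases a) (auto simp: I_def less_Suc_eq not_less intro: order_trans less_imp_le)
    subgoal for a m by (cases a) (auto simp: I_def less_Suc_eq_le)
    done
qed

lemma wp_trace_back:
  assumes "filled (Suc n) 0 m0" "t \<le> L"
  shows "wp (trace_back n rt t)
    (\<lambda>s m. table m = table m0 \<and> clock m \<le> clock m0 + 7 * n + 1
       \<and> s \<in> lists {1..n} \<and> S n t \<le> ereal (V s)) m0"
proof -
  \<comment> \<open>Until a boundary entry is reached, every round lowers the index by at least one;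
    so after \<open>n\<close> rounds \<open>i + n \<le> n\<close> leaves only \<open>i = 0\<close>.
    A full round costs \<open>7\<close> operations including its test.\<close>
  define I where "I = (\<lambda>j (i, u, s) (m :: machine). table m = table m0 \<and> choice m = choice m0
    \<and> clock m \<le> clock m0 + 7 * j \<and> i \<le> n \<and> u \<le> L \<and> (i = 0 \<or> u < rt i \<or> i + j \<le> n)
    \<and> completes (S n t) i u s)"
  have ok: "choice m0 i u < i \<and> S i u = extension i u (choice m0 i u)"
    if "0 < i" "i \<le> n" "u \<le> L" "rt i \<le> u" for i u
    using assms(1) that by (auto simp: filled_def entry_ok_def)
  show ?thesis
    unfolding trace_back_def wp_simps
    apply (rule wp_for_loop[where I = I])
    subgoal using assms completes_Nil by (auto simp: I_def)
    subgoal by simp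
    subgoal for j a m
    proof (cases a)
      case (fields i u s)
      assume I: "I j a m"
      show ?thesis
      proof (cases "0 < i \<and> rt i \<le> u")
        case True
        with I have "0 < i" "rt i \<le> u" "i \<le> n" "u \<le> L" "completes (S n t) i u s"
          by (auto simp: I_def fields)
        with ok[of i u] have "completes (S n t) (choice m0 i u) (u - rt i) (i # s)"
          by (intro completes_step) auto
        then show ?thesis using I True ok[of i u] by (auto simp: I_def fields)
      qed (use I in \<open>auto simp: I_def fields\<close>)
    qed
    subgoal for a m
      using completes_boundary by (cases a) (auto simp: I_def completes_def)
    done
qed

section \<open>Composition of the phases and the total running time\<close>

lemma wp_dp_algorithm:
  "wp (dp_algorithm n rt q P)
     (\<lambda>s m. (\<forall>i\<in>{0..n}. \<forall>t\<in>{0..L}. table m i t = S i t) \<and> optimal_sequence n rt q P s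
        \<and> clock m \<le> clock m0 + 10 * n + 5 * L + 8 + n * row_time) m0"
  unfolding dp_algorithm_def wp_simps
proof (rule wp_mono[OF wp_compute_horizon], elim conjE, hypsubst)
  fix m1 :: machine assume m1: "clock m1 \<le> clock m0 + 3 * n + 1"
  show "wp (fill_table n rt q P L)
    (\<lambda>_. wp (best_end_time n L) (\<lambda>t. wp (trace_back n rt t)
      (\<lambda>s m. (\<forall>i\<in>{0..n}. \<forall>t\<in>{0..L}. table m i t = S i t) \<and> optimal_sequence n rt q P s
        \<and> clock m \<le> clock m0 + 10 * n + 5 * L + 8 + n * row_time))) m1"
  proof (rule wp_mono[OF wp_fill_table], elim conjE)
    fix m2 :: machine assume m2: "filled (Suc n) 0 m2" "clock m2 \<le> clock m1 + 2 * L + 4 + n * row_time"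
    then have tab: "table m2 i t = S i t" if "i \<le> n" "t \<le> L" for i t
      using that by (auto simp: filled_def entry_ok_def)
    show "wp (best_end_time n L) (\<lambda>t. wp (trace_back n rt t)
      (\<lambda>s m. (\<forall>i\<in>{0..n}. \<forall>t\<in>{0..L}. table m i t = S i t) \<and> optimal_sequence n rt q P s
        \<and> clock m \<le> clock m0 + 10 * n + 5 * L + 8 + n * row_time)) m2"
    proof (rule wp_mono[OF wp_best_end_time], use tab in simp, elim conjE)
      fix t and m3 :: machine
      assume m3: "table m3 = table m2" "choice m3 = choice m2" "clock m3 \<le> clock m2 + 3 * L + 2"
        and t: "t \<le> L" "\<forall>t'\<le>L. S n t' \<le> S n t"
      have "filled (Suc n) 0 m3" using m2 m3 by (simp add: filled_def entry_ok_def)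
      from wp_trace_back[OF this t(1)]
      show "wp (trace_back n rt t)
        (\<lambda>s m. (\<forall>i\<in>{0..n}. \<forall>t\<in>{0..L}. table m i t = S i t) \<and> optimal_sequence n rt q P s
          \<and> clock m \<le> clock m0 + 10 * n + 5 * L + 8 + n * row_time) m3"
        \<comment> \<open>The entry at the selected end time \<open>t\<close> is the maximum of row
          \<open>n\<close>, and the traced sequence attains at least that value.\<close>
        by (rule wp_mono) (use t tab m1 m2 m3 in \<open>auto intro!: optimal_if_dominates_row[where v = "S n t"]\<close>)
    qed
  qed
qed

end

text \<open>For positive \<open>n\<close> and \<open>L\<close> every monomial of the expanded cost
  is at most \<open>n\<^sup>2 * L\<close>; the coefficients \<open>27 + 5 + 8 + 15 + 8 + 8\<close>
  add up to \<open>71\<close>.\<close>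

lemma time_bound:
  fixes n L :: nat
  assumes "0 < n" "0 < L"
  shows "10 * n + 5 * L + 8 + n * (2 + (L + 1) * (15 + 8 * n)) \<le> 71 * (n\<^sup>2 * L)"
proof -
  let ?X = "n\<^sup>2 * L"
  have "1 \<le> ?X" "n \<le> ?X" "L \<le> ?X" "n * L \<le> ?X" "n * n \<le> ?X"
    using assms by (auto simp: power2_eq_square)
  moreover have "10 * n + 5 * L + 8 + n * (2 + (L + 1) * (15 + 8 * n)) =
      27 * n + 5 * L + 8 + 15 * (n * L) + 8 * (n * n) + 8 * ?X"
    by (simp add: algebra_simps power2_eq_square)
  ultimately show ?thesis by linarith
qed

theorem theorem3:
  shows "\<exists>c :: nat. \<forall>(n :: nat) (rt :: nat \<Rightarrow> nat) (q :: nat \<Rightarrow> real) (D :: real measure)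
           (m0 :: machine) (s :: nat list) (m :: machine).
     rules_by_quality n q \<longrightarrow> real_distribution D \<longrightarrow> clock m0 = 0 \<longrightarrow>
     run_state (dp_algorithm n rt q (cdf D)) m0 = (s, m) \<longrightarrow>
       (\<forall>i\<in>{0..n}. \<forall>t\<in>{0..total_runtime n rt}. table m i t = dp_table rt q (cdf D) i t)
       \<and> optimal_sequence n rt q (cdf D) s
       \<and> (0 < total_runtime n rt \<longrightarrow> clock m \<le> c * (n ^ 2 * total_runtime n rt))"
proof (rule exI[of _ 71], intro allI impI)
  fix n rt q D and m0 m :: machine and s
  assume rules: "rules_by_quality n q" and D: "real_distribution D" and m0: "clock m0 = 0"
    and run: "run_state (dp_algorithm n rt q (cdf D)) m0 = (s, m)"
  interpret D: real_distribution D by (fact D)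
  interpret deadline_problem n rt q "cdf D"
    by unfold_locales (use rules D.cdf_nondecreasing D.cdf_bounded_prob in \<open>auto intro: monoI\<close>)
  \<comment> \<open>An empty rule set would have total runtime \<open>0\<close>.\<close>
  have "0 < n" if "0 < L" using that by (cases n) (auto simp: total_runtime_def)
  then have "10 * n + 5 * L + 8 + n * row_time \<le> 71 * (n\<^sup>2 * L)" if "0 < L"
    using that by (intro time_bound) auto
  then show "(\<forall>i\<in>{0..n}. \<forall>t\<in>{0..L}. table m i t = S i t) \<and> optimal_sequence n rt q (cdf D) s
      \<and> (0 < L \<longrightarrow> clock m \<le> 71 * (n\<^sup>2 * L))"
    using wp_dp_algorithm[of m0] m0 by (fastforce simp: wp_def run)
qed

end
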